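(* Let $t \ge 1$ be an integer and let $G$ be a graph which does not admit $K_t$ as a weak immersion. Then either $G$ has $(t,t^2)$-bounded degree, or there exist graphs $G_1, G_2$, neither of which admits a weak immersion of $K_t$, and an integer $k$ with $0 \le k < t^2$, such that $G$ is a grounded $k$-edge sum of $G_1$ and $G_2$ and, moreover, $|V(G_1)| < |V(G)|$ and $|V(G_2)| < |V(G)|$.
   Context: Graphs are finite and may have multiple (parallel) edges but no loops. $\deg(v)$ is the number of edges incident with $v$, and $\delta(v)$ is the set of edges incident with $v$. $K_t$ is the complete graph on $t$ vertices. Weak immersion: $G$ admits a weak immersion of $H$ if there is an injection $\pi_v: V(H)\to V(G)$ and a map $\pi_e$ from $E(H)$ to subgraphs of $G$ such that for every edge $f$ of $H$ with endpoints $x,y$, $\pi_e(f)$ is a path with endpoints $\pi_v(x),\pi_v(y)$, and for distinct edges $f,f'$ of $H$ the paths $\pi_e(f),\pi_e(f')$ have no edge in common. $(\alpha,\beta)$-bounded degree: for nonnegative integers $\alpha,\beta$, a graph has $(\alpha,\beta)$-bounded degree if at most $\alpha$ of its vertices have degree at least $\beta$. Edge sum: let $k\ge 0$. $G$ is a $k$-edge sum of (disjoint) graphs $G_1$ and $G_2$ if there exist vertices $v_i\in V(G_i)$ with $\deg_{G_i}(v_i)=k$ for $i=1,2$ and a bijection $\pi:\delta(v_1)\to\delta(v_2)$ such that $G$ is obtained from $(G_1-v_1)\cup(G_2-v_2)$ by adding, for each $e_1\in\delta(v_1)$ with ends $x,v_1$ and $e_2=\pi(e_1)$ with ends $y,v_2$,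 an edge from $x$ to $y$. The edge sum is grounded if there exist vertices $v_1'\in V(G_1)$, $v_2'\in V(G_2)$ such that for $i=1,2$, $v_i'\ne v_i$ and there are $k$ pairwise edge-disjoint paths in $G_i$ linking $v_i$ and $v_i'$. *)

theory Defs
  imports Main
begin

record ('v, 'e) mgraph =
  verts :: "'v set"
  edges :: "'e set"
  ends :: "'e \<Rightarrow> 'v set"

definition multigraph :: "('v, 'e) mgraph \<Rightarrow> bool" where
  "multigraph G \<longleftrightarrow> finite (verts G) \<and> finite (edges G) \<and>
     (\<forall>e \<in> edges G. ends G e \<subseteq> verts G \<and> card (ends G e) = 2)"

definition incident_edges :: "('v, 'e) mgraph \<Rightarrow> 'v \<Rightarrow> 'e set" where
  "incident_edges G v = {e \<in> edges G. v \<in> ends G e}"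

definition degree :: "('v, 'e) mgraph \<Rightarrow> 'v \<Rightarrow> nat" where
  "degree G v = card (incident_edges G v)"

definition bounded_degree :: "nat \<Rightarrow> nat \<Rightarrow> ('v, 'e) mgraph \<Rightarrow> bool" where
  "bounded_degree \<alpha> \<beta> G \<longleftrightarrow> card {v \<in> verts G. \<beta> \<le> degree G v} \<le> \<alpha>"

definition complete_graph :: "nat \<Rightarrow> (nat, nat set) mgraph" where
  "complete_graph t =
     \<lparr>verts = {..<t}, edges = {A. A \<subseteq> {..<t} \<and> card A = 2}, ends = (\<lambda>A. A)\<rparr>"

text \<open>The value of \<open>ends\<close> outside the edge set carries no meaning, so it is
  ignored by the subgraph and isomorphism relations.\<close>

definition subgraph :: "('v, 'e) mgraph \<Rightarrow> ('v, 'e) mgraph \<Rightarrow> bool" where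
  "subgraph H G \<longleftrightarrow> multigraph H \<and> verts H \<subseteq> verts G \<and> edges H \<subseteq> edges G \<and>
     (\<forall>e \<in> edges H. ends H e = ends G e)"

definition isomorphic :: "('v, 'e) mgraph \<Rightarrow> ('w, 'f) mgraph \<Rightarrow> bool" where
  "isomorphic G H \<longleftrightarrow>
     (\<exists>\<phi> \<psi>. bij_betw \<phi> (verts G) (verts H) \<and> bij_betw \<psi> (edges G) (edges H) \<and>
       (\<forall>e \<in> edges G. ends H (\<psi> e) = \<phi> ` ends G e))"

text \<open>\<open>path_graph P x y\<close>: the graph \<open>P\<close> is a path with endpoints \<open>x\<close> and \<open>y\<close>.
  Distinctness of the edges in \<open>es\<close> follows from that of the vertices.\<close>

definition path_graph :: "('v, 'e) mgraph \<Rightarrow> 'v \<Rightarrow> 'v \<Rightarrow> bool" where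
  "path_graph P x y \<longleftrightarrow>
     (\<exists>vs es. length vs = Suc (length es) \<and> distinct vs \<and>
       set vs = verts P \<and> set es = edges P \<and> hd vs = x \<and> last vs = y \<and>
       (\<forall>i < length es. ends P (es ! i) = {vs ! i, vs ! Suc i}))"

definition admits_weak_immersion :: "('v, 'e) mgraph \<Rightarrow> ('w, 'f) mgraph \<Rightarrow> bool" where
  "admits_weak_immersion G H \<longleftrightarrow>
     (\<exists>\<pi>v :: 'w \<Rightarrow> 'v. \<exists>\<pi>e :: 'f \<Rightarrow> ('v, 'e) mgraph.
       inj_on \<pi>v (verts H) \<and> \<pi>v ` verts H \<subseteq> verts G \<and>
       (\<forall>f \<in> edges H. subgraph (\<pi>e f) G \<and>
         (\<forall>x y. ends H f = {x, y} \<longrightarrow> path_graph (\<pi>e f) (\<pi>v x) (\<pi>v y))) \<and>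
       (\<forall>f \<in> edges H. \<forall>f' \<in> edges H. f \<noteq> f' \<longrightarrow> edges (\<pi>e f) \<inter> edges (\<pi>e f') = {}))"

text \<open>The edge sum of two disjoint graphs along a bijection \<open>\<pi>\<close> between the edges at
  \<open>v1\<close> and the edges at \<open>v2\<close>. An edge \<open>e\<close> at \<open>v1\<close> disappears from \<open>G1 - v1\<close>, and
  its name is reused for the new edge arising from the pair \<open>e\<close>, \<open>\<pi> e\<close>.\<close>

definition edge_sum ::
  "('v, 'e) mgraph \<Rightarrow> 'v \<Rightarrow> ('v, 'e) mgraph \<Rightarrow> 'v \<Rightarrow> ('e \<Rightarrow> 'e) \<Rightarrow> ('v, 'e) mgraph" where
  "edge_sum G1 v1 G2 v2 \<pi> =
     \<lparr>verts = (verts G1 - {v1}) \<union> (verts G2 - {v2}),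
      edges = edges G1 \<union> (edges G2 - incident_edges G2 v2),
      ends = (\<lambda>e. if e \<in> incident_edges G1 v1
                  then (ends G1 e - {v1}) \<union> (ends G2 (\<pi> e) - {v2})
                  else if e \<in> edges G1 then ends G1 e else ends G2 e)\<rparr>"

definition is_edge_sum_at ::
  "nat \<Rightarrow> ('u, 'd) mgraph \<Rightarrow> ('v, 'e) mgraph \<Rightarrow> 'v \<Rightarrow> ('v, 'e) mgraph \<Rightarrow> 'v \<Rightarrow> bool" where
  "is_edge_sum_at k G G1 v1 G2 v2 \<longleftrightarrow>
     verts G1 \<inter> verts G2 = {} \<and> edges G1 \<inter> edges G2 = {} \<and>
     v1 \<in> verts G1 \<and> v2 \<in> verts G2 \<and> degree G1 v1 = k \<and> degree G2 v2 = k \<and>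
     (\<exists>\<pi>. bij_betw \<pi> (incident_edges G1 v1) (incident_edges G2 v2) \<and>
       isomorphic G (edge_sum G1 v1 G2 v2 \<pi>))"

definition edge_disjoint_paths :: "nat \<Rightarrow> ('v, 'e) mgraph \<Rightarrow> 'v \<Rightarrow> 'v \<Rightarrow> bool" where
  "edge_disjoint_paths k G x y \<longleftrightarrow>
     (\<exists>P :: nat \<Rightarrow> ('v, 'e) mgraph.
       (\<forall>i < k. subgraph (P i) G \<and> path_graph (P i) x y) \<and>
       (\<forall>i < k. \<forall>j < k. i \<noteq> j \<longrightarrow> edges (P i) \<inter> edges (P j) = {}))"

definition is_grounded_edge_sum ::
  "nat \<Rightarrow> ('u, 'd) mgraph \<Rightarrow> ('v, 'e) mgraph \<Rightarrow> ('v, 'e) mgraph \<Rightarrow> bool" where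
  "is_grounded_edge_sum k G G1 G2 \<longleftrightarrow>
     (\<exists>v1 v2. is_edge_sum_at k G G1 v1 G2 v2 \<and>
       (\<exists>v1' \<in> verts G1. v1' \<noteq> v1 \<and> edge_disjoint_paths k G1 v1 v1') \<and>
       (\<exists>v2' \<in> verts G2. v2' \<noteq> v2 \<and> edge_disjoint_paths k G2 v2 v2'))"

end

theory Submission
  imports Defs "HOL-Library.Transitive_Closure_Table"
begin

text \<open>If \<open>G\<close> does not have \<open>(t, t\<^sup>2)\<close>-bounded degree, it has more than \<open>t\<close> vertices of degree at
  least \<open>t\<^sup>2\<close>; call them big. Two cases arise, according to how well the big vertices are
  connected to each other.

  If every edge boundary that separates two big vertices has at least \<open>t\<^sup>2\<close> edges, pick a big
  vertex \<open>v\<close> as a hub and \<open>t\<close> further big vertices as branch vertices. By Menger's theorem there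
  are \<open>t\<^sup>2\<close> edge-disjoint paths from \<open>v\<close>, of which \<open>t\<close> end in each branch vertex. Joining them in
  pairs at \<open>v\<close> gives a weak immersion of \<open>K\<^sub>t\<close> (\<open>complete_graph_immersion_of_hub\<close>), which is
  excluded.

  Otherwise some two big vertices \<open>x\<close> and \<open>y\<close> are separated by fewer than \<open>t\<^sup>2\<close> edges. Take a set
  \<open>S\<close> containing \<open>x\<close> but not \<open>y\<close> whose boundary has the minimum number \<open>k\<close> of edges. Contracting
  either side of the boundary to a single vertex gives the two summands of a \<open>k\<close>-edge sum. By
  Menger's theorem and the minimality of \<open>k\<close> there are \<open>k\<close> edge-disjoint paths from \<open>x\<close> to \<open>y\<close>.
  Their images in the contractions show that the sum is grounded. Moreover each of them crosses
  the boundary exactly once, so their parts on the far side connect the boundary edges to \<open>y\<close>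
  (or \<open>x\<close>) disjointly. Hence \<open>G\<close> weakly immerses both contractions
  (\<open>contraction.admits_weak_immersion_H\<close>), and neither of them can admit \<open>K\<^sub>t\<close>. Both sides of the
  boundary have at least two vertices, because the boundary of a single big vertex is too large;
  hence the contractions have fewer vertices than \<open>G\<close>.

  Both uses of Menger's theorem are instances of \<open>menger_demands\<close>, a version with one source and
  several targets with demands. It is proved by augmenting a unit-capacity flow and decomposing
  the result. Throughout, paths are replaced by edge sets in which their ends are
  connected: such sets can be united, mapped and restricted freely, and shortened to paths at
  the very end.\<close>

section \<open>Linking two vertices inside an edge set\<close>

definition adjacent_in :: "('v, 'e) mgraph \<Rightarrow> 'e set \<Rightarrow> 'v \<Rightarrow> 'v \<Rightarrow> bool" where
  "adjacent_in G F u w \<longleftrightarrow> (\<exists>e \<in> F. ends G e = {u, w})"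

definition linked :: "('v, 'e) mgraph \<Rightarrow> 'e set \<Rightarrow> 'v \<Rightarrow> 'v \<Rightarrow> bool" where
  "linked G F = (adjacent_in G F)\<^sup>*\<^sup>*"

lemma linked_refl: "linked G F x x"
  by (simp add: linked_def)

lemma linked_edge: "e \<in> F \<Longrightarrow> ends G e = {x, y} \<Longrightarrow> linked G F x y"
  unfolding linked_def by (rule r_into_rtranclp) (auto simp: adjacent_in_def)

lemma linked_trans: "linked G F x y \<Longrightarrow> linked G F y z \<Longrightarrow> linked G F x z"
  unfolding linked_def by (rule rtranclp_trans)

lemma linked_sym:
  assumes "linked G F x y"
  shows "linked G F y x"
proof -
  have "symp (adjacent_in G F)"
    by (auto simp: symp_def adjacent_in_def insert_commute)
  then have "symp (linked G F)"
    unfolding linked_def by (rule symp_rtranclp)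
  then show ?thesis using assms by (auto dest: sympD)
qed

lemma linked_mono: "linked G F x y \<Longrightarrow> F \<subseteq> F' \<Longrightarrow> linked G F' x y"
  unfolding linked_def
  by (erule rtranclp_mono[THEN predicate2D, rotated]) (auto 0 4 simp: adjacent_in_def)

lemma linked_map:
  assumes "linked H F x y"
    and step: "\<And>e u w. e \<in> F \<Longrightarrow> ends H e = {u, w} \<Longrightarrow> linked G F' (\<rho> u) (\<rho> w)"
  shows "linked G F' (\<rho> x) (\<rho> y)"
  using assms(1) unfolding linked_def[of H]
proof (induction rule: rtranclp_induct)
  case base
  then show ?case by (rule linked_refl)
next
  case (step u w)
  then show ?case using assms(2) by (metis adjacent_in_def linked_trans)
qed

lemma multigraph_ends:
  assumes "multigraph G" "e \<in> edges G"
  obtains u w where "ends G e = {u, w}" "u \<noteq> w" "u \<in> verts G" "w \<in> verts G"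
proof -
  have "ends G e \<subseteq> verts G" "card (ends G e) = 2"
    using assms by (auto simp: multigraph_def)
  then show ?thesis using that by (auto simp: card_2_iff)
qed

lemma edge_list_of_rtrancl_path:
  assumes "rtrancl_path (adjacent_in G F) x xs y"
  shows "\<exists>es. length es = length xs \<and> set es \<subseteq> F \<and> last (x # xs) = y \<and>
    (\<forall>i < length es. ends G (es ! i) = {(x # xs) ! i, xs ! i})"
  using assms
proof (induction rule: rtrancl_path.induct)
  case (base x)
  then show ?case by auto
next
  case (step x y ys z)
  then obtain es e where es: "length es = length ys" "set es \<subseteq> F" "last (y # ys) = z"
    "\<forall>i < length es. ends G (es ! i) = {(y # ys) ! i, ys ! i}"
    and e: "e \<in> F" "ends G e = {x, y}"
    by (auto simp: adjacent_in_def)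
  show ?case
    by (rule exI[of _ "e # es"]) (use es e in \<open>auto simp: nth_Cons split: nat.split\<close>)
qed

text \<open>A shortcut argument: a walk that repeats a vertex can be shortened, so reachability
  already gives a path in the sense of \<^const>\<open>path_graph\<close>.\<close>

lemma path_of_linked:
  assumes G: "multigraph G" and F: "F \<subseteq> edges G" and x: "x \<in> verts G" and l: "linked G F x y"
  shows "\<exists>P. subgraph P G \<and> path_graph P x y \<and> edges P \<subseteq> F"
proof -
  obtain xs where p: "rtrancl_path (adjacent_in G F) x xs y" and d: "distinct (x # xs)"
    using l unfolding linked_def rtranclp_eq_rtrancl_path by (metis rtrancl_path_distinct)
  obtain es where es: "length es = length xs" "set es \<subseteq> F" "last (x # xs) = y"
    "\<forall>i < length es. ends G (es ! i) = {(x # xs) ! i, xs ! i}"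
    using edge_list_of_rtrancl_path[OF p] by blast
  define P where "P = \<lparr>verts = set (x # xs), edges = set es, ends = ends G\<rparr>"
  have "path_graph P x y"
    unfolding path_graph_def
    by (rule exI[of _ "x # xs"], rule exI[of _ es]) (use es d in \<open>auto simp: P_def\<close>)
  moreover have inV: "ends G e \<subseteq> set (x # xs)" if e: "e \<in> set es" for e
  proof -
    obtain i where i: "i < length es" "e = es ! i" using e by (auto simp: in_set_conv_nth)
    then have "(x # xs) ! i \<in> set (x # xs)" "xs ! i \<in> set (x # xs)"
      using es(1) nth_mem[of i "x # xs"] nth_mem[of i xs] by auto
    then show ?thesis using i es(4) by auto
  qed
  moreover have "set (x # xs) \<subseteq> verts G"
  proof
    fix z assume "z \<in> set (x # xs)"
    then consider "z = x" | i where "i < length es" "z = xs ! i"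
      using es(1) by (auto simp: in_set_conv_nth)
    then show "z \<in> verts G"
    proof cases
      case 2
      have "es ! i \<in> edges G" using 2(1) es(2) F by (meson nth_mem subsetD)
      moreover have "z \<in> ends G (es ! i)" using 2 es(4) by simp
      ultimately show ?thesis using G by (auto simp: multigraph_def)
    qed (use x in simp)
  qed
  ultimately show ?thesis
    using G F es(2) by (intro exI[of _ P]) (auto simp: P_def subgraph_def multigraph_def)
qed

lemma linked_of_path:
  assumes "subgraph P G" "path_graph P x y"
  shows "linked G (edges P) x y"
proof -
  obtain vs es where l: "length vs = Suc (length es)" and es: "set es = edges P"
    and h: "hd vs = x" "last vs = y"
    and i: "\<forall>i < length es. ends P (es ! i) = {vs ! i, vs ! Suc i}"
    using assms(2) unfolding path_graph_def by blast
  have "linked G (edges P) (vs ! 0) (vs ! n)" if "n \<le> length es" for n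
    using that
  proof (induction n)
    case 0
    show ?case by (rule linked_refl)
  next
    case (Suc n)
    have e: "es ! n \<in> edges P" using es Suc.prems nth_mem[of n es] by simp
    then have "ends G (es ! n) = {vs ! n, vs ! Suc n}"
      using assms(1) i Suc.prems unfolding subgraph_def by (metis Suc_le_eq)
    with e have "linked G (edges P) (vs ! n) (vs ! Suc n)" by (rule linked_edge)
    then show ?case using Suc by (simp add: linked_trans[of G "edges P" _ "vs ! n"])
  qed
  moreover have "vs \<noteq> []" using l by auto
  ultimately show ?thesis
    using l h hd_conv_nth[of vs] last_conv_nth[of vs] by auto
qed

lemma path_graph_sym:
  assumes "path_graph P x y"
  shows "path_graph P y x"
proof -
  obtain vs es where *: "length vs = Suc (length es)" "distinct vs"
    "set vs = verts P" "set es = edges P" "hd vs = x" "last vs = y"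
    "\<forall>i < length es. ends P (es ! i) = {vs ! i, vs ! Suc i}"
    using assms unfolding path_graph_def by blast
  have "ends P (rev es ! i) = {rev vs ! i, rev vs ! Suc i}" if "i < length es" for i
  proof -
    have "ends P (es ! (length es - Suc i)) =
        {vs ! (length es - Suc i), vs ! Suc (length es - Suc i)}"
      using *(7) that by simp
    moreover have "Suc (length es - Suc i) = length es - i" using that by simp
    ultimately show ?thesis
      using that *(1) by (simp add: rev_nth insert_commute)
  qed
  moreover have "vs \<noteq> []" using *(1) by auto
  ultimately show ?thesis
    unfolding path_graph_def using *(1-6)
    by (intro exI[of _ "rev vs"] exI[of _ "rev es"]) (simp add: hd_rev last_rev)
qed

section \<open>Weak immersions in terms of linking edge sets\<close>

text \<open>Paths only matter through the edge sets that they occupy. The right-hand side is easier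
  to produce, since overlapping pieces of walks may be united without any shortening.\<close>

lemma admits_weak_immersion_iff_linked:
  assumes G: "multigraph G" and H: "multigraph H"
  shows "admits_weak_immersion G H \<longleftrightarrow>
    (\<exists>\<pi> F. inj_on \<pi> (verts H) \<and> \<pi> ` verts H \<subseteq> verts G \<and>
      (\<forall>f \<in> edges H. F f \<subseteq> edges G \<and>
        (\<forall>x y. ends H f = {x, y} \<longrightarrow> linked G (F f) (\<pi> x) (\<pi> y))) \<and>
      (\<forall>f \<in> edges H. \<forall>f' \<in> edges H. f \<noteq> f' \<longrightarrow> F f \<inter> F f' = {}))"
    (is "?L \<longleftrightarrow> ?R")
proof
  assume ?L
  then obtain \<pi> \<pi>e where "inj_on \<pi> (verts H)" "\<pi> ` verts H \<subseteq> verts G"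
    "\<forall>f \<in> edges H. subgraph (\<pi>e f) G \<and>
      (\<forall>x y. ends H f = {x, y} \<longrightarrow> path_graph (\<pi>e f) (\<pi> x) (\<pi> y))"
    "\<forall>f \<in> edges H. \<forall>f' \<in> edges H. f \<noteq> f' \<longrightarrow> edges (\<pi>e f) \<inter> edges (\<pi>e f') = {}"
    unfolding admits_weak_immersion_def by blast
  then show ?R
    by (intro exI[of _ \<pi>] exI[of _ "\<lambda>f. edges (\<pi>e f)"])
      (metis linked_of_path subgraph_def)
next
  assume ?R
  then obtain \<pi> F where \<pi>: "inj_on \<pi> (verts H)" "\<pi> ` verts H \<subseteq> verts G"
    and F: "\<And>f. f \<in> edges H \<Longrightarrow> F f \<subseteq> edges G"
      "\<And>f x y. f \<in> edges H \<Longrightarrow> ends H f = {x, y} \<Longrightarrow> linked G (F f) (\<pi> x) (\<pi> y)"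
    and disj: "\<And>f f'. f \<in> edges H \<Longrightarrow> f' \<in> edges H \<Longrightarrow> f \<noteq> f' \<Longrightarrow> F f \<inter> F f' = {}"
    by metis
  have "\<exists>P. subgraph P G \<and> (\<forall>x y. ends H f = {x, y} \<longrightarrow> path_graph P (\<pi> x) (\<pi> y)) \<and>
      edges P \<subseteq> F f" if f: "f \<in> edges H" for f
  proof -
    obtain u w where uw: "ends H f = {u, w}" "u \<in> verts H"
      using multigraph_ends[OF H f] by metis
    have "\<pi> u \<in> verts G" using uw \<pi>(2) by auto
    then obtain P where "subgraph P G" "path_graph P (\<pi> u) (\<pi> w)" "edges P \<subseteq> F f"
      using path_of_linked[OF G F(1)[OF f] _ F(2)[OF f uw(1)]] by blast
    then show ?thesis
      using uw(1) by (intro exI[of _ P]) (auto simp: doubleton_eq_iff intro: path_graph_sym)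
  qed
  then obtain \<pi>e where \<pi>e: "\<And>f. f \<in> edges H \<Longrightarrow> subgraph (\<pi>e f) G \<and>
      (\<forall>x y. ends H f = {x, y} \<longrightarrow> path_graph (\<pi>e f) (\<pi> x) (\<pi> y)) \<and> edges (\<pi>e f) \<subseteq> F f"
    by metis
  have "edges (\<pi>e f) \<inter> edges (\<pi>e f') = {}"
    if "f \<in> edges H" "f' \<in> edges H" "f \<noteq> f'" for f f'
  proof -
    have "edges (\<pi>e f) \<subseteq> F f" "edges (\<pi>e f') \<subseteq> F f'" using \<pi>e that(1,2) by blast+
    then show ?thesis using disj[OF that] by blast
  qed
  then show ?L
    unfolding admits_weak_immersion_def using \<pi> \<pi>e
    by (intro exI[of _ \<pi>] exI[of _ \<pi>e]) simp
qed

text \<open>Replace every edge of \<open>K\<close> on a path for an edge of \<open>H\<close> by the edge set that represents it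
  in \<open>G\<close>.\<close>

lemma admits_weak_immersion_trans:
  assumes G: "multigraph G" and K: "multigraph K" and H: "multigraph H"
    and GK: "admits_weak_immersion G K" and KH: "admits_weak_immersion K H"
  shows "admits_weak_immersion G H"
proof -
  obtain \<rho> L where \<rho>: "inj_on \<rho> (verts K)" "\<rho> ` verts K \<subseteq> verts G"
    and L: "\<And>n. n \<in> edges K \<Longrightarrow> L n \<subseteq> edges G"
      "\<And>n x y. n \<in> edges K \<Longrightarrow> ends K n = {x, y} \<Longrightarrow> linked G (L n) (\<rho> x) (\<rho> y)"
      "\<And>n n'. n \<in> edges K \<Longrightarrow> n' \<in> edges K \<Longrightarrow> n \<noteq> n' \<Longrightarrow> L n \<inter> L n' = {}"
    using GK unfolding admits_weak_immersion_iff_linked[OF G K] by metis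
  obtain \<pi> F where \<pi>: "inj_on \<pi> (verts H)" "\<pi> ` verts H \<subseteq> verts K"
    and F: "\<And>f. f \<in> edges H \<Longrightarrow> F f \<subseteq> edges K"
      "\<And>f x y. f \<in> edges H \<Longrightarrow> ends H f = {x, y} \<Longrightarrow> linked K (F f) (\<pi> x) (\<pi> y)"
      "\<And>f f'. f \<in> edges H \<Longrightarrow> f' \<in> edges H \<Longrightarrow> f \<noteq> f' \<Longrightarrow> F f \<inter> F f' = {}"
    using KH unfolding admits_weak_immersion_iff_linked[OF K H] by metis
  have link: "linked G (\<Union> (L ` F f)) (\<rho> (\<pi> x)) (\<rho> (\<pi> y))"
    if f: "f \<in> edges H" "ends H f = {x, y}" for f x y
    using F(2)[OF f]
  proof (rule linked_map)
    fix e u w assume "e \<in> F f" "ends K e = {u, w}"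
    then show "linked G (\<Union> (L ` F f)) (\<rho> u) (\<rho> w)"
      using F(1)[OF f(1)] L(2) by (blast intro: linked_mono)
  qed
  have disj: "\<Union> (L ` F f) \<inter> \<Union> (L ` F f') = {}"
    if f: "f \<in> edges H" "f' \<in> edges H" "f \<noteq> f'" for f f'
  proof -
    have "L n \<inter> L n' = {}" if "n \<in> F f" "n' \<in> F f'" for n n'
      using that F(1)[OF f(1)] F(1)[OF f(2)] F(3)[OF f] L(3)[of n n'] by blast
    then show ?thesis by blast
  qed
  have comp: "inj_on (\<lambda>z. \<rho> (\<pi> z)) (verts H)"
    using comp_inj_on[OF \<pi>(1) inj_on_subset[OF \<rho>(1) \<pi>(2)]] by (simp add: comp_def)
  show ?thesis
    unfolding admits_weak_immersion_iff_linked[OF G H]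
  proof (intro exI[of _ "\<lambda>z. \<rho> (\<pi> z)"] exI[of _ "\<lambda>f. \<Union> (L ` F f)"] conjI ballI allI impI)
    show "(\<lambda>z. \<rho> (\<pi> z)) ` verts H \<subseteq> verts G" using \<rho>(2) \<pi>(2) by auto
    show "\<Union> (L ` F f) \<subseteq> edges G" if "f \<in> edges H" for f
      using L(1) F(1)[OF that] by blast
  qed (rule comp link disj; assumption?)+
qed

lemma multigraph_complete_graph: "multigraph (complete_graph t)"
proof -
  have "finite {A. A \<subseteq> {..<t} \<and> card A = 2}"
    by (rule finite_subset[of _ "Pow {..<t}"]) auto
  then show ?thesis by (auto simp: multigraph_def complete_graph_def)
qed

section \<open>Unit flows\<close>

definition edge_boundary :: "('v, 'e) mgraph \<Rightarrow> 'v set \<Rightarrow> 'e set" where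
  "edge_boundary G S = {e \<in> edges G. ends G e \<inter> S \<noteq> {} \<and> \<not> ends G e \<subseteq> S}"

text \<open>An arbitrary reference orientation turns a flow in an undirected graph into a function
  with values in \<open>{-1, 0, 1}\<close>: the sign tells in which direction an edge is used.\<close>

locale oriented_multigraph =
  fixes G :: "('v, 'e) mgraph" and source target :: "'e \<Rightarrow> 'v"
  assumes multigraph: "multigraph G"
    and ends_eq: "e \<in> edges G \<Longrightarrow> ends G e = {source e, target e}"
begin

lemma finite_edges: "finite (edges G)" and finite_verts: "finite (verts G)"
  using multigraph by (auto simp: multigraph_def)

lemma ends_in_verts: "e \<in> edges G \<Longrightarrow> source e \<in> verts G" "e \<in> edges G \<Longrightarrow> target e \<in> verts G"
  using multigraph ends_eq by (auto simp: multigraph_def)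

definition outflow :: "('e \<Rightarrow> int) \<Rightarrow> 'v \<Rightarrow> int" where
  "outflow f z = (\<Sum>e \<in> edges G. f e * (of_bool (source e = z) - of_bool (target e = z)))"

lemma outflow_add: "outflow (\<lambda>e. f e + g e) z = outflow f z + outflow g z"
  by (simp add: outflow_def distrib_right sum.distrib)

lemma outflow_diff: "outflow (\<lambda>e. f e - g e) z = outflow f z - outflow g z"
  by (simp add: outflow_def left_diff_distrib sum_subtractf)

lemma outflow_update:
  assumes "e \<in> edges G" "f e = 0"
  shows "outflow (f(e := c)) z =
    outflow f z + c * (of_bool (source e = z) - of_bool (target e = z))"
proof -
  have "outflow (f(e := c)) z = c * (of_bool (source e = z) - of_bool (target e = z)) +
      (\<Sum>e' \<in> edges G - {e}. f e' * (of_bool (source e' = z) - of_bool (target e' = z)))"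
    unfolding outflow_def by (subst sum.remove[OF finite_edges assms(1)]) simp
  moreover have "outflow f z =
      (\<Sum>e' \<in> edges G - {e}. f e' * (of_bool (source e' = z) - of_bool (target e' = z)))"
    unfolding outflow_def by (subst sum.remove[OF finite_edges assms(1)]) (simp add: assms(2))
  ultimately show ?thesis by simp
qed

text \<open>Edges inside \<open>S\<close> cancel, so only the edges that cross the boundary of \<open>S\<close> count.\<close>

lemma sum_outflow:
  assumes "finite S"
  shows "(\<Sum>z \<in> S. outflow f z) =
    (\<Sum>e \<in> edges G. f e * (of_bool (source e \<in> S) - of_bool (target e \<in> S)))"
proof -
  have ind: "(\<Sum>z \<in> S. of_bool (u = z)) = (of_bool (u \<in> S) :: int)" for u
    using assms by (simp add: of_bool_def sum.delta)
  have "(\<Sum>z \<in> S. outflow f z) =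
    (\<Sum>e \<in> edges G. \<Sum>z \<in> S. f e * (of_bool (source e = z) - of_bool (target e = z)))"
    unfolding outflow_def by (rule sum.swap)
  then show ?thesis
    by (simp add: sum_distrib_left[symmetric] sum_subtractf ind)
qed

lemma sum_outflow_verts: "(\<Sum>z \<in> verts G. outflow f z) = 0"
  unfolding sum_outflow[OF finite_verts] by (rule sum.neutral) (simp add: ends_in_verts)

text \<open>\<open>P\<close> and \<open>N\<close> tell which edges may be traversed along and against the reference orientation.
  Suitable choices give the residual graph of a flow as well as the darts that carry it.\<close>

definition dart :: "('e \<Rightarrow> bool) \<Rightarrow> ('e \<Rightarrow> bool) \<Rightarrow> 'v \<Rightarrow> 'v \<Rightarrow> bool" where
  "dart P N u w \<longleftrightarrow> (\<exists>e \<in> edges G.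
     (P e \<and> source e = u \<and> target e = w) \<or> (N e \<and> target e = u \<and> source e = w))"

text \<open>One construction serves to augment a flow, by adding \<open>\<chi>\<close> found in the residual graph, and
  to split a path off a flow, by subtracting \<open>\<chi>\<close> found among the darts that carry it.\<close>

lemma unit_flow_of_path:
  assumes "rtrancl_path (dart P N) x xs y" "distinct (x # xs)"
  shows "\<exists>\<chi> :: 'e \<Rightarrow> int. (\<forall>e. \<chi> e \<in> {-1, 0, 1}) \<and>
    (\<forall>e. \<chi> e \<noteq> 0 \<longrightarrow> e \<in> edges G \<and> ends G e \<subseteq> set (x # xs)) \<and>
    (\<forall>e. \<chi> e = 1 \<longrightarrow> P e) \<and> (\<forall>e. \<chi> e = -1 \<longrightarrow> N e) \<and>
    (\<forall>z. outflow \<chi> z = of_bool (z = x) - of_bool (z = y)) \<and>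
    linked G {e. \<chi> e \<noteq> 0} x y"
  using assms
proof (induction rule: rtrancl_path.induct)
  case (base x)
  then show ?case
    by (intro exI[of _ "\<lambda>_. 0"]) (auto simp: outflow_def linked_refl)
next
  case (step x y ys z)
  then obtain \<chi> :: "'e \<Rightarrow> int" where \<chi>: "\<And>e. \<chi> e \<in> {-1, 0, 1}"
    "\<And>e. \<chi> e \<noteq> 0 \<Longrightarrow> e \<in> edges G \<and> ends G e \<subseteq> set (y # ys)"
    "\<And>e. \<chi> e = 1 \<Longrightarrow> P e" "\<And>e. \<chi> e = -1 \<Longrightarrow> N e"
    "\<And>v. outflow \<chi> v = of_bool (v = y) - of_bool (v = z)" "linked G {e. \<chi> e \<noteq> 0} y z"
    by fastforce
  from step(1) obtain e c where e: "e \<in> edges G" "c = 1 \<or> c = (-1 :: int)"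
    "c = 1 \<Longrightarrow> P e \<and> source e = x \<and> target e = y"
    "c = -1 \<Longrightarrow> N e \<and> target e = x \<and> source e = y"
  proof -
    from step(1) obtain e where "e \<in> edges G"
      "(P e \<and> source e = x \<and> target e = y) \<or> (N e \<and> target e = x \<and> source e = y)"
      by (auto simp: dart_def)
    then show ?thesis using that[of e 1] that[of e "-1"] by auto
  qed
  have ends: "ends G e = {x, y}" using e ends_eq[OF e(1)] by auto
  \<comment> \<open>The vertex \<open>x\<close> does not recur, so the first edge is not used a second time.\<close>
  have zero: "\<chi> e = 0" using \<chi>(2)[of e] ends step.prems by auto
  have "linked G {e'. (\<chi>(e := c)) e' \<noteq> 0} x y"
    using e(2) ends by (intro linked_edge[of e]) auto
  moreover have "linked G {e'. (\<chi>(e := c)) e' \<noteq> 0} y z"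
    using \<chi>(6) by (rule linked_mono) (use e(2) in auto)
  ultimately have "linked G {e'. (\<chi>(e := c)) e' \<noteq> 0} x z" by (rule linked_trans)
  moreover have "outflow (\<chi>(e := c)) v = of_bool (v = x) - of_bool (v = z)" for v
    unfolding outflow_update[OF e(1), of \<chi>, OF zero] \<chi>(5) using e(2-4) by auto
  moreover have "\<forall>e'. (\<chi>(e := c)) e' \<in> {-1, 0, 1}" using \<chi>(1) e(2) by auto
  moreover have "\<forall>e'. (\<chi>(e := c)) e' \<noteq> 0 \<longrightarrow> e' \<in> edges G \<and> ends G e' \<subseteq> set (x # y # ys)"
  proof (intro allI impI)
    fix e' assume "(\<chi>(e := c)) e' \<noteq> 0"
    then show "e' \<in> edges G \<and> ends G e' \<subseteq> set (x # y # ys)"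
      using \<chi>(2)[of e'] e(1) ends by (cases "e' = e") auto
  qed
  moreover have "\<forall>e'. (\<chi>(e := c)) e' = 1 \<longrightarrow> P e'" "\<forall>e'. (\<chi>(e := c)) e' = -1 \<longrightarrow> N e'"
    using \<chi>(3,4) e by auto
  ultimately show ?case by (intro exI[of _ "\<chi>(e := c)"]) blast
qed

lemma unit_flow_of_reachable:
  assumes "(dart P N)\<^sup>*\<^sup>* x y"
  obtains \<chi> :: "'e \<Rightarrow> int" where "\<And>e. \<chi> e \<in> {-1, 0, 1}" "{e. \<chi> e \<noteq> 0} \<subseteq> edges G"
    "\<And>e. \<chi> e = 1 \<Longrightarrow> P e" "\<And>e. \<chi> e = -1 \<Longrightarrow> N e"
    "\<And>z. outflow \<chi> z = of_bool (z = x) - of_bool (z = y)"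
    "linked G {e. \<chi> e \<noteq> 0} x y"
proof -
  obtain xs where "rtrancl_path (dart P N) x xs y" "distinct (x # xs)"
    using assms unfolding rtranclp_eq_rtrancl_path by (metis rtrancl_path_distinct)
  from unit_flow_of_path[OF this] show ?thesis using that by blast
qed

lemma reachable_in_verts:
  assumes "(dart P N)\<^sup>*\<^sup>* v z" "v \<in> verts G"
  shows "z \<in> verts G"
  using assms by (induction rule: rtranclp_induct) (auto simp: dart_def ends_in_verts)

text \<open>The outflow at the source \<open>v\<close> is left out because the outflows of all vertices sum to
  zero, which fixes it to be the total demand.\<close>

definition supplies :: "('e \<Rightarrow> int) \<Rightarrow> 'v \<Rightarrow> 'v set \<Rightarrow> ('v \<Rightarrow> nat) \<Rightarrow> bool" where
  "supplies f v X d \<longleftrightarrow> (\<forall>e. f e \<in> {-1, 0, 1}) \<and>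
     (\<forall>z \<in> verts G - {v}. outflow f z = - int (if z \<in> X then d z else 0))"

lemma sum_outflow_supplies:
  assumes "supplies f v X d" "v \<in> S" "S \<subseteq> verts G" "X \<subseteq> verts G"
  shows "(\<Sum>z \<in> S. outflow f z) = int (\<Sum>x \<in> X - S. d x)"
proof -
  have "(\<Sum>z \<in> S. outflow f z) = - (\<Sum>z \<in> verts G - S. outflow f z)"
    using sum_outflow_verts[of f] sum.subset_diff[OF assms(3) finite_verts, of "outflow f"] by simp
  also have "(\<Sum>z \<in> verts G - S. outflow f z) =
      (\<Sum>z \<in> verts G - S. - int (if z \<in> X then d z else 0))"
    using assms(1,2) unfolding supplies_def by (intro sum.cong refl) blast
  also have "\<dots> = - (\<Sum>z \<in> verts G - S. int (if z \<in> X then d z else 0))"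
    by (simp add: sum_negf)
  also have "(\<Sum>z \<in> verts G - S. int (if z \<in> X then d z else 0)) = (\<Sum>z \<in> X - S. int (d z))"
    using assms(4) finite_verts by (intro sum.mono_neutral_cong_right) auto
  finally show ?thesis by simp
qed

text \<open>Augmenting paths: if no unsatisfied demand is reachable in the residual graph, then the
  reachable set has all its boundary edges saturated outwards, so its boundary is too small
  for the demand outside it.\<close>

lemma flow_exists:
  assumes v: "v \<in> verts G" and X: "X \<subseteq> verts G - {v}"
    and cuts: "\<And>S. v \<in> S \<Longrightarrow> S \<subseteq> verts G \<Longrightarrow> (\<Sum>x \<in> X - S. D x) \<le> card (edge_boundary G S)"
    and n: "n \<le> sum D X"
  shows "\<exists>f d. supplies f v X d \<and> (\<forall>x \<in> X. d x \<le> D x) \<and> sum d X = n"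
  using n
proof (induction n)
  case 0
  then show ?case
    by (intro exI[of _ "\<lambda>_. 0"]) (simp add: supplies_def outflow_def)
next
  case (Suc n)
  then obtain f d where f: "supplies f v X d" and d: "\<forall>x \<in> X. d x \<le> D x" "sum d X = n"
    by auto
  have XV: "X \<subseteq> verts G" using X by blast
  then have fin: "finite X" using finite_verts finite_subset by blast
  define R where "R = dart (\<lambda>e. f e < 1) (\<lambda>e. f e > -1)"
  define S where "S = {z. R\<^sup>*\<^sup>* v z}"
  have S: "v \<in> S" "S \<subseteq> verts G"
    using reachable_in_verts v by (auto simp: S_def R_def)
  have f01: "f e \<in> {-1, 0, 1}" for e using f by (auto simp: supplies_def)
  have closed: "w \<in> S" if "u \<in> S" "R u w" for u w
    using that by (auto simp: S_def intro: rtranclp.rtrancl_into_rtrancl)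
  have "\<exists>x \<in> X \<inter> S. d x < D x"
  proof (rule ccontr)
    assume "\<not> ?thesis"
    then have eq: "\<And>x. x \<in> X \<inter> S \<Longrightarrow> d x = D x" using d(1) by force
    have "f e * (of_bool (source e \<in> S) - of_bool (target e \<in> S)) = of_bool (e \<in> edge_boundary G S)"
      if e: "e \<in> edges G" for e
    proof -
      have "\<not> f e < 1" if "source e \<in> S" "target e \<notin> S"
        using closed[OF that(1), of "target e"] that(2) e by (auto simp: R_def dart_def)
      moreover have "\<not> f e > -1" if "source e \<notin> S" "target e \<in> S"
        using closed[OF that(2), of "source e"] that(1) e by (auto simp: R_def dart_def)
      ultimately show ?thesis using f01[of e] e by (auto simp: edge_boundary_def ends_eq)
    qed
    then have "(\<Sum>z \<in> S. outflow f z) = (\<Sum>e \<in> edges G. of_bool (e \<in> edge_boundary G S))"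
      unfolding sum_outflow[OF finite_subset[OF S(2) finite_verts]] by (rule sum.cong[OF refl])
    also have "\<dots> = int (card (edge_boundary G S))"
      using finite_edges by (auto simp: of_bool_def sum.If_cases edge_boundary_def Int_def intro: arg_cong[of _ _ card])
    finally have "(\<Sum>x \<in> X - S. d x) = card (edge_boundary G S)"
      using sum_outflow_supplies[OF f S XV] by linarith
    then have "(\<Sum>x \<in> X - S. D x) \<le> (\<Sum>x \<in> X - S. d x)"
      using cuts[OF S] by simp
    moreover have "(\<Sum>x \<in> X \<inter> S. D x) = (\<Sum>x \<in> X \<inter> S. d x)"
      using eq by simp
    ultimately have "sum D X \<le> sum d X"
      using sum.Int_Diff[OF fin, of D S] sum.Int_Diff[OF fin, of d S] by simp
    then show False using d(2) Suc.prems by simp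
  qed
  then obtain x where x: "x \<in> X" "x \<in> S" "d x < D x" by auto
  then obtain \<chi> :: "'e \<Rightarrow> int" where \<chi>: "\<And>e. \<chi> e \<in> {-1, 0, 1}"
    "\<And>e. \<chi> e = 1 \<Longrightarrow> f e < 1" "\<And>e. \<chi> e = -1 \<Longrightarrow> f e > -1"
    "\<And>z. outflow \<chi> z = of_bool (z = v) - of_bool (z = x)"
    unfolding S_def R_def mem_Collect_eq by (elim unit_flow_of_reachable) (rule that; blast)
  have "f e + \<chi> e \<in> {-1, 0, 1}" for e
    using f01[of e] \<chi>(1)[of e] \<chi>(2,3)[of e] by auto
  moreover have "outflow (\<lambda>e. f e + \<chi> e) z = - int (if z \<in> X then (d(x := Suc (d x))) z else 0)"
    if "z \<in> verts G - {v}" for z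
    using that f x(1) by (auto simp: outflow_add \<chi>(4) supplies_def)
  ultimately have "supplies (\<lambda>e. f e + \<chi> e) v X (d(x := Suc (d x)))"
    by (auto simp: supplies_def)
  moreover have "sum (d(x := Suc (d x))) X = Suc n"
    using d(2) x(1) fin by (simp add: sum.remove[of X x] sum.remove[of X x d])
  moreover have "\<forall>y \<in> X. (d(x := Suc (d x))) y \<le> D y"
    using d(1) x(3) by simp
  ultimately show ?case by blast
qed

text \<open>Flow decomposition: the set reached by following the flow cannot have positive net
  outflow, hence it contains a vertex of positive demand. Removing a path to such a vertex
  lowers its demand by one.\<close>

lemma flow_decomposition:
  assumes v: "v \<in> verts G" and X: "X \<subseteq> verts G - {v}"
    and "supplies f v X d"
  shows "\<exists>F. (\<forall>x \<in> X. \<forall>j < d x. F x j \<subseteq> edges G \<inter> {e. f e \<noteq> 0} \<and> linked G (F x j) v x) \<and>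
    (\<forall>x \<in> X. \<forall>j < d x. \<forall>x' \<in> X. \<forall>j' < d x'. (x, j) \<noteq> (x', j') \<longrightarrow> F x j \<inter> F x' j' = {})"
  using assms(3)
proof (induction "sum d X" arbitrary: f d)
  case 0
  have "finite X" using X finite_verts finite_subset by blast
  then have "\<forall>x \<in> X. d x = 0" using 0 by simp
  then show ?case by auto
next
  case (Suc n)
  have XV: "X \<subseteq> verts G" using X by blast
  then have fin: "finite X" using finite_verts finite_subset by blast
  define R where "R = dart (\<lambda>e. f e = 1) (\<lambda>e. f e = -1)"
  define S where "S = {z. R\<^sup>*\<^sup>* v z}"
  have S: "v \<in> S" "S \<subseteq> verts G"
    using reachable_in_verts v by (auto simp: S_def R_def)
  have f01: "f e \<in> {-1, 0, 1}" for e using Suc.prems by (auto simp: supplies_def)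
  have closed: "w \<in> S" if "u \<in> S" "R u w" for u w
    using that by (auto simp: S_def intro: rtranclp.rtrancl_into_rtrancl)
  have "\<exists>x \<in> X \<inter> S. 0 < d x"
  proof (rule ccontr)
    assume "\<not> ?thesis"
    then have "(\<Sum>x \<in> X \<inter> S. d x) = 0" by simp
    moreover have "f e * (of_bool (source e \<in> S) - of_bool (target e \<in> S)) \<le> 0"
      if e: "e \<in> edges G" for e
    proof -
      have "f e \<noteq> 1" if "source e \<in> S" "target e \<notin> S"
        using closed[OF that(1), of "target e"] that(2) e by (auto simp: R_def dart_def)
      moreover have "f e \<noteq> -1" if "source e \<notin> S" "target e \<in> S"
        using closed[OF that(2), of "source e"] that(1) e by (auto simp: R_def dart_def)
      ultimately show ?thesis using f01[of e] by auto
    qed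
    then have "(\<Sum>z \<in> S. outflow f z) \<le> 0"
      unfolding sum_outflow[OF finite_subset[OF S(2) finite_verts]] by (rule sum_nonpos)
    then have "(\<Sum>x \<in> X - S. d x) = 0"
      using sum_outflow_supplies[OF Suc.prems S XV] by linarith
    ultimately show False
      using sum.Int_Diff[OF fin, of d S] Suc.hyps(2) by simp
  qed
  then obtain x where x: "x \<in> X" "x \<in> S" "0 < d x" by auto
  then obtain \<chi> :: "'e \<Rightarrow> int" where \<chi>: "\<And>e. \<chi> e \<in> {-1, 0, 1}" "{e. \<chi> e \<noteq> 0} \<subseteq> edges G"
    "\<And>e. \<chi> e = 1 \<Longrightarrow> f e = 1" "\<And>e. \<chi> e = -1 \<Longrightarrow> f e = -1"
    "\<And>z. outflow \<chi> z = of_bool (z = v) - of_bool (z = x)" "linked G {e. \<chi> e \<noteq> 0} v x"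
    using unit_flow_of_reachable[of "\<lambda>e. f e = 1" "\<lambda>e. f e = -1" v x]
    by (auto simp: S_def R_def)
  define d' where "d' = d(x := d x - 1)"
  have val: "f e - \<chi> e \<in> {-1, 0, 1}" "f e - \<chi> e \<noteq> 0 \<longleftrightarrow> f e \<noteq> 0 \<and> \<chi> e = 0"
    "\<chi> e \<noteq> 0 \<Longrightarrow> f e \<noteq> 0" for e
    using f01[of e] \<chi>(1)[of e] \<chi>(3,4)[of e] by auto
  have "outflow (\<lambda>e. f e - \<chi> e) z = - int (if z \<in> X then d' z else 0)"
    if "z \<in> verts G - {v}" for z
    using that Suc.prems x by (auto simp: outflow_diff \<chi>(5) supplies_def d'_def)
  then have supp: "supplies (\<lambda>e. f e - \<chi> e) v X d'"
    using val(1) by (auto simp: supplies_def)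
  have n: "n = sum d' X"
    using Suc.hyps(2) x fin by (simp add: d'_def sum.remove[of X x] sum.remove[of X x d])
  obtain F where F:
    "\<forall>y \<in> X. \<forall>j < d' y.
      F y j \<subseteq> edges G \<inter> {e. f e \<noteq> 0 \<and> \<chi> e = 0} \<and> linked G (F y j) v y"
    "\<forall>y \<in> X. \<forall>j < d' y. \<forall>y' \<in> X. \<forall>j' < d' y'. (y, j) \<noteq> (y', j') \<longrightarrow> F y j \<inter> F y' j' = {}"
    using Suc.hyps(1)[OF n supp] unfolding val(2) by (elim exE conjE) (rule that)
  note F = F[rule_format]
  define F' where "F' y j = (if y = x \<and> j = d x - 1 then {e. \<chi> e \<noteq> 0} else F y j)" for y j
  have old: "j < d' y" if "j < d y" "\<not> (y = x \<and> j = d x - 1)" for y j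
    using that by (auto simp: d'_def)
  have "F' y j \<subseteq> edges G \<inter> {e. f e \<noteq> 0} \<and> linked G (F' y j) v y" if "y \<in> X" "j < d y" for y j
  proof (cases "y = x \<and> j = d x - 1")
    case True
    then have "F' y j = {e. \<chi> e \<noteq> 0}" by (simp add: F'_def)
    moreover have "{e. \<chi> e \<noteq> 0} \<subseteq> {e. f e \<noteq> 0}" using val(3) by blast
    ultimately show ?thesis using \<chi>(2,6) True by (metis Int_subset_iff)
  next
    case False
    then have eq: "F' y j = F y j" by (auto simp: F'_def)
    show ?thesis unfolding eq using F(1)[OF that(1) old[OF that(2) False]] by blast
  qed
  moreover have "F' y j \<inter> F' y' j' = {}"
    if y: "y \<in> X" "j < d y" and y': "y' \<in> X" "j' < d y'" and ne: "(y, j) \<noteq> (y', j')" for y j y' j'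
  proof -
    consider "y = x \<and> j = d x - 1" "\<not> (y' = x \<and> j' = d x - 1)"
      | "\<not> (y = x \<and> j = d x - 1)" "y' = x \<and> j' = d x - 1"
      | "\<not> (y = x \<and> j = d x - 1)" "\<not> (y' = x \<and> j' = d x - 1)"
      using ne by blast
    then show ?thesis
    proof cases
      case 1
      then have eq: "F' y j = {e. \<chi> e \<noteq> 0}" "F' y' j' = F y' j'" unfolding F'_def by presburger+
      show ?thesis unfolding eq using F(1)[OF y'(1) old[OF y'(2) 1(2)]] by blast
    next
      case 2
      then have eq: "F' y j = F y j" "F' y' j' = {e. \<chi> e \<noteq> 0}" unfolding F'_def by presburger+
      show ?thesis unfolding eq using F(1)[OF y(1) old[OF y(2) 2(1)]] by blast
    next
      case 3
      then have eq: "F' y j = F y j" "F' y' j' = F y' j'" unfolding F'_def by presburger+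
      show ?thesis
        unfolding eq by (rule F(2)[OF y(1) old[OF y(2) 3(1)] y'(1) old[OF y'(2) 3(2)] ne])
    qed
  qed
  ultimately show ?case by (intro exI[of _ F']) blast
qed

end

section \<open>Menger's theorem with demands\<close>

text \<open>This amounts to Menger's theorem for the graph with a new vertex joined to every \<open>x \<in> X\<close> by
  \<open>D x\<close> parallel edges: the boundary of \<open>S\<close> in that graph has \<open>D x\<close> additional edges for each
  \<open>x \<in> X \<inter> S\<close>, so asking for \<open>sum D X\<close> edges there is the condition stated here.\<close>

theorem menger_demands:
  assumes G: "multigraph G" and v: "v \<in> verts G" and X: "X \<subseteq> verts G - {v}"
    and cuts: "\<And>S. v \<in> S \<Longrightarrow> S \<subseteq> verts G \<Longrightarrow> (\<Sum>x \<in> X - S. D x) \<le> card (edge_boundary G S)"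
  obtains F :: "'v \<Rightarrow> nat \<Rightarrow> 'e set"
  where "\<And>x j. x \<in> X \<Longrightarrow> j < D x \<Longrightarrow> F x j \<subseteq> edges G"
    "\<And>x j. x \<in> X \<Longrightarrow> j < D x \<Longrightarrow> linked G (F x j) v x"
    "\<And>x j x' j'. x \<in> X \<Longrightarrow> j < D x \<Longrightarrow> x' \<in> X \<Longrightarrow> j' < D x' \<Longrightarrow> (x, j) \<noteq> (x', j') \<Longrightarrow>
      F x j \<inter> F x' j' = {}"
proof -
  have "\<exists>s t. ends G e = {s, t}" if "e \<in> edges G" for e
    using multigraph_ends[OF G that] by metis
  then obtain s t where "\<And>e. e \<in> edges G \<Longrightarrow> ends G e = {s e, t e}" by metis
  then interpret oriented_multigraph G s t
    using G by unfold_locales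
  obtain f d where f: "supplies f v X d" and d: "\<forall>x \<in> X. d x \<le> D x" "sum d X = sum D X"
    using flow_exists[OF v X cuts order_refl] by blast
  have "finite X" using X finite_verts finite_subset by blast
  then have "d x = D x" if "x \<in> X" for x
    using d that sum_strict_mono_ex1[of X d D] by (metis le_neq_implies_less less_irrefl)
  then show ?thesis
    using flow_decomposition[OF v X f] that by (smt (verit) le_inf_iff)
qed

corollary menger_edge_disjoint:
  fixes G :: "('v, 'e) mgraph"
  assumes G: "multigraph G" and xy: "x \<in> verts G" "y \<in> verts G" "x \<noteq> y"
    and cuts: "\<And>S. x \<in> S \<Longrightarrow> y \<notin> S \<Longrightarrow> S \<subseteq> verts G \<Longrightarrow> k \<le> card (edge_boundary G S)"
  obtains F :: "nat \<Rightarrow> 'e set"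
  where "\<And>j. j < k \<Longrightarrow> F j \<subseteq> edges G" "\<And>j. j < k \<Longrightarrow> linked G (F j) x y"
    "\<And>i j. i < k \<Longrightarrow> j < k \<Longrightarrow> i \<noteq> j \<Longrightarrow> F i \<inter> F j = {}"
proof (rule menger_demands[where D = "\<lambda>_. k" and X = "{y}", OF G xy(1)])
  show "{y} \<subseteq> verts G - {x}" using xy by auto
  show "(\<Sum>z \<in> {y} - S. k) \<le> card (edge_boundary G S)" if "x \<in> S" "S \<subseteq> verts G" for S
  proof (cases "y \<in> S")
    case False
    then have "{y} - S = {y}" by auto
    then show ?thesis using cuts[OF that(1) False that(2)] by simp
  qed simp
next
  fix F :: "'v \<Rightarrow> nat \<Rightarrow> 'e set"
  assume F: "\<And>x j. x \<in> {y} \<Longrightarrow> j < k \<Longrightarrow> F x j \<subseteq> edges G"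
    "\<And>z j. z \<in> {y} \<Longrightarrow> j < k \<Longrightarrow> linked G (F z j) x z"
    "\<And>x j x' j'. x \<in> {y} \<Longrightarrow> j < k \<Longrightarrow> x' \<in> {y} \<Longrightarrow> j' < k \<Longrightarrow> (x, j) \<noteq> (x', j') \<Longrightarrow>
      F x j \<inter> F x' j' = {}"
  show thesis by (rule that[of "F y"]) (use F in simp_all)
qed

section \<open>Contracting one side of an edge boundary\<close>

lemma edge_boundary_subset: "edge_boundary G S \<subseteq> edges G"
  by (auto simp: edge_boundary_def)

lemma edge_boundary_complement:
  assumes "multigraph G"
  shows "edge_boundary G (verts G - S) = edge_boundary G S"
proof -
  have "ends G e \<subseteq> verts G" if "e \<in> edges G" for e
    using assms that by (auto simp: multigraph_def)
  then show ?thesis unfolding edge_boundary_def by blast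
qed

lemma linked_crosses_boundary:
  assumes F: "F \<subseteq> edges G" and "linked G F x y" "x \<in> S" "y \<notin> S"
  shows "F \<inter> edge_boundary G S \<noteq> {}"
proof
  assume none: "F \<inter> edge_boundary G S = {}"
  have "z \<in> S" if "linked G F x z" for z
    using that unfolding linked_def
  proof (induction rule: rtranclp_induct)
    case (step u z)
    then obtain e where e: "e \<in> F" "ends G e = {u, z}" by (auto simp: adjacent_in_def)
    then have "e \<notin> edge_boundary G S" "e \<in> edges G" using none F by auto
    then show ?case using e(2) step.IH by (auto simp: edge_boundary_def)
  qed (rule assms(3))
  then show False using assms by blast
qed

text \<open>A walk whose only possible crossing of the boundary is the edge \<open>e\<close> enters the outside of
  \<open>S\<close> always at the outer end \<open>u\<close> of \<open>e\<close>; the part after the last such entry stays outside.\<close>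

lemma linked_outside:
  assumes F: "F \<subseteq> edges G" and "linked G F x y" "x \<in> S" "y \<notin> S"
    and e: "F \<inter> edge_boundary G S = {e}" and u: "u \<in> ends G e" "u \<notin> S"
    and G: "multigraph G"
  shows "linked G {e' \<in> F. ends G e' \<inter> S = {}} u y"
proof -
  have unique: "z = u" if "z \<in> ends G e" "z \<notin> S" for z
  proof -
    have "e \<in> edges G" "ends G e \<inter> S \<noteq> {}" using e by (auto simp: edge_boundary_def)
    then show ?thesis using that u by (elim multigraph_ends[OF G]) auto
  qed
  have "z \<in> S \<or> linked G {e' \<in> F. ends G e' \<inter> S = {}} u z" if "linked G F x z" for z
    using that unfolding linked_def[of G F]
  proof (induction rule: rtranclp_induct)
    case base
    then show ?case using assms(3) by simp
  next
    case (step z z')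
    then obtain e' where e': "e' \<in> F" "ends G e' = {z, z'}" by (auto simp: adjacent_in_def)
    consider "z' \<in> S" | "z' \<notin> S" "z \<in> S" | "z' \<notin> S" "z \<notin> S" by blast
    then show ?case
    proof cases
      case 2
      then have "e' \<in> edge_boundary G S" using e' F by (auto simp: edge_boundary_def)
      then have "e' = e" using e e'(1) by blast
      then have "z' = u" using unique 2 e'(2) by auto
      then show ?thesis by (simp add: linked_refl)
    next
      case 3
      then have "linked G {e' \<in> F. ends G e' \<inter> S = {}} z z'"
        using e' by (intro linked_edge[of e']) auto
      moreover have "linked G {e' \<in> F. ends G e' \<inter> S = {}} u z" using step.IH 3(2) by simp
      ultimately show ?thesis by (auto intro: linked_trans)
    qed simp
  qed
  then show ?thesis using assms(2,4) by blast
qed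

text \<open>The graph obtained from \<open>G\<close> by identifying all vertices outside \<open>S\<close> to one vertex \<open>w\<close> and
  deleting the resulting loops. The renamings \<open>a\<close> and \<open>b\<close> of vertices and edges allow the two
  contractions belonging to one edge boundary to be disjoint.\<close>

definition contract ::
  "('v, 'e) mgraph \<Rightarrow> 'v set \<Rightarrow> ('v \<Rightarrow> 'w) \<Rightarrow> ('e \<Rightarrow> 'f) \<Rightarrow> 'w \<Rightarrow> ('w, 'f) mgraph" where
  "contract G S a b w =
     \<lparr>verts = insert w (a ` S),
      edges = b ` {e \<in> edges G. ends G e \<inter> S \<noteq> {}},
      ends = (\<lambda>n. (\<lambda>z. if z \<in> S then a z else w) ` ends G (inv_into (edges G) b n))\<rparr>"

locale contraction =
  fixes G :: "('v, 'e) mgraph" and S :: "'v set"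
    and a :: "'v \<Rightarrow> 'w" and b :: "'e \<Rightarrow> 'f" and w :: 'w
  assumes G: "multigraph G" and S: "S \<subseteq> verts G"
    and inj_a: "inj_on a S" and fresh: "w \<notin> a ` S" and inj_b: "inj_on b (edges G)"
begin

abbreviation H where "H \<equiv> contract G S a b w"
abbreviation proj where "proj z \<equiv> if z \<in> S then a z else w"

lemma verts_H: "verts H = insert w (a ` S)"
  and edges_H: "edges H = b ` {e \<in> edges G. ends G e \<inter> S \<noteq> {}}"
  by (simp_all add: contract_def)

lemma ends_H: "e \<in> edges G \<Longrightarrow> ends H (b e) = proj ` ends G e"
  by (simp add: contract_def inj_b)

lemma ends_from_inside:
  assumes "e \<in> edges G" "ends G e \<inter> S \<noteq> {}"
  obtains u z where "ends G e = {u, z}" "u \<noteq> z" "u \<in> S"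
proof -
  obtain p q where pq: "ends G e = {p, q}" "p \<noteq> q" using multigraph_ends[OF G assms(1)] by metis
  then have "p \<in> S \<or> q \<in> S" using assms(2) by auto
  then show ?thesis using pq that[of p q] that[of q p] by (auto simp: insert_commute)
qed

lemma multigraph_H: "multigraph H"
  unfolding multigraph_def
proof (intro conjI ballI)
  show "finite (verts H)" "finite (edges H)"
    using G finite_subset[OF S] by (auto simp: verts_H edges_H multigraph_def)
next
  fix n assume "n \<in> edges H"
  then obtain e where e: "n = b e" "e \<in> edges G" "ends G e \<inter> S \<noteq> {}" by (auto simp: edges_H)
  then obtain u z where uz: "ends G e = {u, z}" "u \<noteq> z" "u \<in> S"
    by (elim ends_from_inside)
  then have "proj u \<noteq> proj z" using inj_a fresh by (auto simp: inj_on_def)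
  moreover have "ends H n = {proj u, proj z}" using ends_H[OF e(2)] e(1) uz(1) by simp
  ultimately show "card (ends H n) = 2" unfolding card_2_iff by blast
  show "ends H n \<subseteq> verts H" using e ends_H by (auto simp: verts_H)
qed

lemma incident_edges_H: "incident_edges H w = b ` edge_boundary G S"
proof -
  have "w \<in> ends H (b e) \<longleftrightarrow> \<not> ends G e \<subseteq> S" if "e \<in> edges G" for e
    using ends_H[OF that] fresh by (auto split: if_splits)
  then show ?thesis
    by (auto simp: incident_edges_def edges_H edge_boundary_def)
qed

lemma degree_H: "degree H w = card (edge_boundary G S)"
  unfolding degree_def incident_edges_H
  by (rule card_image) (rule inj_on_subset[OF inj_b edge_boundary_subset])

lemma card_verts_H: "card (verts H) = Suc (card S)"
proof -
  have "finite S" using G finite_subset[OF S] by (simp add: multigraph_def)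
  then show ?thesis using fresh inj_a by (simp add: verts_H card_image)
qed

lemma linked_H:
  assumes F: "F \<subseteq> edges G" and "linked G F x y"
  shows "linked H (b ` {e \<in> F. ends G e \<inter> S \<noteq> {}}) (proj x) (proj y)"
proof -
  have "linked H (b ` {e \<in> F. ends G e \<inter> S \<noteq> {}}) (proj u) (proj z)"
    if e: "e \<in> F" "ends G e = {u, z}" for e u z
  proof (cases "u \<in> S \<or> z \<in> S")
    case True
    then have "e \<in> {e \<in> F. ends G e \<inter> S \<noteq> {}}" using e by auto
    then have "b e \<in> b ` {e \<in> F. ends G e \<inter> S \<noteq> {}}" by (rule imageI)
    moreover have "ends H (b e) = {proj u, proj z}"
      using ends_H[OF subsetD[OF F e(1)]] e(2) by simp
    ultimately show ?thesis by (rule linked_edge)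
  qed (simp add: linked_refl)
  then show ?thesis by (rule linked_map[OF assms(2), where \<rho> = "\<lambda>z. proj z"])
qed

text \<open>The projection maps the walks from \<open>x\<close> to \<open>y\<close> to walks from \<open>x\<close> to the contracted vertex.\<close>

lemma edge_disjoint_paths_H:
  assumes F: "\<And>j. j < k \<Longrightarrow> F j \<subseteq> edges G" "\<And>j. j < k \<Longrightarrow> linked G (F j) x y"
    "\<And>i j. i < k \<Longrightarrow> j < k \<Longrightarrow> i \<noteq> j \<Longrightarrow> F i \<inter> F j = {}"
    and x: "x \<in> S" and y: "y \<notin> S"
  shows "edge_disjoint_paths k H w (a x)"
proof -
  define F' where "F' j = b ` {e \<in> F j. ends G e \<inter> S \<noteq> {}}" for j
  have "\<exists>P. subgraph P H \<and> path_graph P w (a x) \<and> edges P \<subseteq> F' j" if j: "j < k" for j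
  proof (rule path_of_linked[OF multigraph_H])
    show "F' j \<subseteq> edges H" using F(1)[OF j] by (auto simp: F'_def edges_H)
    show "w \<in> verts H" by (simp add: verts_H)
    show "linked H (F' j) w (a x)"
      using linked_sym[OF linked_H[OF F(1,2)[OF j]]] x y by (simp add: F'_def)
  qed
  then obtain P where P: "\<And>j. j < k \<Longrightarrow> subgraph (P j) H \<and> path_graph (P j) w (a x)"
    "\<And>j. j < k \<Longrightarrow> edges (P j) \<subseteq> F' j"
    by metis
  have "edges (P i) \<inter> edges (P j) = {}" if ij: "i < k" "j < k" "i \<noteq> j" for i j
  proof -
    have "F' i \<inter> F' j = {}"
      using F(3)[OF ij] F(1)[OF ij(1)] F(1)[OF ij(2)] inj_b
      by (auto simp: F'_def dest!: inj_onD[OF inj_b])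
    then show ?thesis using P(2)[OF ij(1)] P(2)[OF ij(2)] by blast
  qed
  then show ?thesis unfolding edge_disjoint_paths_def using P(1) by blast
qed

text \<open>If as many edge-disjoint \<open>x\<close>-\<open>y\<close> paths exist as the boundary has edges, then each of
  them uses exactly one boundary edge, and its part beyond \<open>S\<close> prolongs that edge to \<open>y\<close>.
  With \<open>y\<close> in the role of the contracted vertex, \<open>G\<close> thus contains the contraction as a
  weak immersion.\<close>

lemma admits_weak_immersion_H:
  assumes F: "\<And>j. j < card (edge_boundary G S) \<Longrightarrow> F j \<subseteq> edges G"
    "\<And>j. j < card (edge_boundary G S) \<Longrightarrow> linked G (F j) x y"
    "\<And>i j. i < card (edge_boundary G S) \<Longrightarrow> j < card (edge_boundary G S) \<Longrightarrow> i \<noteq> j \<Longrightarrow>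
      F i \<inter> F j = {}"
    and x: "x \<in> S" and y: "y \<in> verts G - S"
  shows "admits_weak_immersion G H"
proof -
  define k where "k = card (edge_boundary G S)"
  note F = F[folded k_def]
  have "\<exists>e. e \<in> F j \<inter> edge_boundary G S" if "j < k" for j
    using linked_crosses_boundary[OF F(1,2)[OF that] x] y by auto
  then obtain c where c: "\<And>j. j < k \<Longrightarrow> c j \<in> F j \<inter> edge_boundary G S" by metis
  have "inj_on c {..<k}"
  proof (rule inj_onI)
    fix i j assume "i \<in> {..<k}" "j \<in> {..<k}" "c i = c j"
    then show "i = j" using c[of i] c[of j] F(3)[of i j] by auto
  qed
  \<comment> \<open>Counting: \<open>k\<close> disjoint sets that each meet a set of \<open>k\<close> edges meet it in one edge each.\<close>
  then have "card (c ` {..<k}) = card (edge_boundary G S)" by (simp add: card_image k_def)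
  moreover have "finite (edge_boundary G S)"
    using G by (intro finite_subset[OF edge_boundary_subset]) (simp add: multigraph_def)
  moreover have "c ` {..<k} \<subseteq> edge_boundary G S" using c by auto
  ultimately have surj: "c ` {..<k} = edge_boundary G S" by (metis card_subset_eq)
  have single: "F j \<inter> edge_boundary G S = {c j}" if j: "j < k" for j
  proof -
    have "e = c j" if e: "e \<in> F j" "e \<in> edge_boundary G S" for e
    proof -
      obtain i where i: "i < k" "e = c i" using e(2) surj by auto
      then show ?thesis using F(3)[OF i(1) j] c[OF i(1)] e(1) by auto
    qed
    then show ?thesis using c[OF j] by auto
  qed
  have "\<exists>j. j < k \<and> c j = e" if "e \<in> edge_boundary G S" for e
    using surj that by (metis imageE lessThan_iff)
  then obtain J where J: "\<And>e. e \<in> edge_boundary G S \<Longrightarrow> J e < k \<and> c (J e) = e" by metis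
  define Q where "Q e = {e' \<in> F (J e). ends G e' \<inter> S = {}}" for e
  have Q: "linked G (Q e) u y" if e: "e \<in> edge_boundary G S" and u: "u \<in> ends G e" "u \<notin> S" for e u
  proof -
    have j: "J e < k" "c (J e) = e" using J[OF e] by auto
    show ?thesis
      unfolding Q_def using linked_outside[OF F(1,2)[OF j(1)] x _ _ u G] single[OF j(1)] j(2) y
      by auto
  qed
  define prolong where "prolong e = insert e (if e \<in> edge_boundary G S then Q e else {})" for e
  define \<beta> where "\<beta> = inv_into (edges G) b"
  have \<beta>: "\<beta> (b e) = e" if "e \<in> edges G" for e
    using inj_b that by (simp add: \<beta>_def)
  \<comment> \<open>The contracted vertex is represented by \<open>y\<close>, every other vertex by itself.\<close>
  define \<rho> where "\<rho> p = (if p = w then y else inv_into S a p)" for p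
  have \<rho>: "\<rho> (proj z) = (if z \<in> S then z else y)" for z
    using inj_a fresh by (auto simp: \<rho>_def)
  have \<rho>_a: "\<rho> (a z) = z" if "z \<in> S" for z
    using \<rho>[of z] that by simp
  have \<rho>_w: "\<rho> w = y" by (simp add: \<rho>_def)
  show ?thesis
    unfolding admits_weak_immersion_iff_linked[OF G multigraph_H]
  proof (intro exI[of _ \<rho>] exI[of _ "\<lambda>n. prolong (\<beta> n)"] conjI ballI allI impI)
    show "inj_on \<rho> (verts H)"
      using y by (auto simp: inj_on_def verts_H \<rho>_a \<rho>_w)
    show "\<rho> ` verts H \<subseteq> verts G"
      using y S by (auto simp: verts_H \<rho>_a \<rho>_w)
  next
    fix n assume "n \<in> edges H"
    then obtain e where e: "n = b e" "e \<in> edges G" "ends G e \<inter> S \<noteq> {}" by (auto simp: edges_H)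
    show "prolong (\<beta> n) \<subseteq> edges G"
      using e \<beta> F(1) J by (auto simp: prolong_def Q_def)
    fix p q assume pq: "ends H n = {p, q}"
    obtain u z where uz: "ends G e = {u, z}" "u \<in> S"
      using e(2,3) by (elim ends_from_inside)
    have 1: "linked G (prolong e) u z"
      using uz(1) by (intro linked_edge[of e]) (auto simp: prolong_def)
    have "linked G (prolong e) u (\<rho> (proj z))"
    proof (cases "z \<in> S")
      case False
      then have bd: "e \<in> edge_boundary G S" using e uz by (auto simp: edge_boundary_def)
      have "linked G (Q e) z y" using Q[OF bd] uz False by auto
      then have "linked G (prolong e) z y" by (rule linked_mono) (use bd in \<open>auto simp: prolong_def\<close>)
      then show ?thesis using linked_trans[OF 1] False by (simp add: \<rho>_w)
    qed (use 1 in \<open>simp add: \<rho>_a\<close>)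
    then have 2: "linked G (prolong e) (\<rho> (proj u)) (\<rho> (proj z))"
      using uz(2) by (simp add: \<rho>_a)
    have "ends H n = {proj u, proj z}" using ends_H[OF e(2)] e(1) uz(1) by simp
    then have "{p, q} = {proj u, proj z}" unfolding pq .
    then have "p = proj u \<and> q = proj z \<or> p = proj z \<and> q = proj u"
      by (simp only: doubleton_eq_iff)
    then show "linked G (prolong (\<beta> n)) (\<rho> p) (\<rho> q)"
      unfolding e(1) \<beta>[OF e(2)] using 2 linked_sym[OF 2] by (elim disjE conjE) simp_all
  next
    fix n n' assume "n \<in> edges H" "n' \<in> edges H" "n \<noteq> n'"
    then obtain e e' where e: "n = b e" "e \<in> edges G" "ends G e \<inter> S \<noteq> {}"
      and e': "n' = b e'" "e' \<in> edges G" "ends G e' \<inter> S \<noteq> {}" and ne: "e \<noteq> e'"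
      by (auto simp: edges_H)
    have "F (J e) \<inter> F (J e') = {}" if "e \<in> edge_boundary G S" "e' \<in> edge_boundary G S"
      using F(3) J[OF that(1)] J[OF that(2)] ne by metis
    then have "prolong e \<inter> prolong e' = {}"
      using e(3) e'(3) ne unfolding prolong_def Q_def by auto
    then show "prolong (\<beta> n) \<inter> prolong (\<beta> n') = {}"
      using e e' \<beta> by simp
  qed
qed

end

section \<open>Splitting along a minimum boundary\<close>

text \<open>The two contractions are realised on natural numbers. Vertices keep a common numbering
  below \<open>n\<close>, and the contracted vertices are \<open>n\<close> and \<open>Suc n\<close>. A boundary edge survives in both
  contractions, so the edge numbers are shifted by \<open>m\<close> in the second one.\<close>

lemma grounded_edge_sum_of_boundary:
  fixes G :: "('v, 'e) mgraph"
  assumes G: "multigraph G" and S: "S \<subseteq> verts G" and x: "x \<in> S" and y: "y \<in> verts G - S"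
    and k: "k = card (edge_boundary G S)"
    and F: "\<And>j. j < k \<Longrightarrow> F j \<subseteq> edges G" "\<And>j. j < k \<Longrightarrow> linked G (F j) x y"
      "\<And>i j. i < k \<Longrightarrow> j < k \<Longrightarrow> i \<noteq> j \<Longrightarrow> F i \<inter> F j = {}"
  obtains G1 G2 :: "(nat, nat) mgraph" where "multigraph G1" "multigraph G2"
    "admits_weak_immersion G G1" "admits_weak_immersion G G2" "is_grounded_edge_sum k G G1 G2"
    "card (verts G1) = Suc (card S)" "card (verts G2) = Suc (card (verts G - S))"
proof -
  have fin: "finite (verts G)" "finite (edges G)" using G by (auto simp: multigraph_def)
  obtain a :: "'v \<Rightarrow> nat" and n where a: "a ` verts G = {i. i < n}" "inj_on a (verts G)"
    using finite_imp_inj_to_nat_seg[OF fin(1)] by blast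
  obtain b :: "'e \<Rightarrow> nat" and m where b: "b ` edges G = {i. i < m}" "inj_on b (edges G)"
    using finite_imp_inj_to_nat_seg[OF fin(2)] by blast
  have an: "a z < n" if "z \<in> verts G" for z using a(1) that by auto
  have bm: "b e < m" if "e \<in> edges G" for e using b(1) that by auto
  define T where "T = verts G - S"
  define b' where "b' = (\<lambda>e. m + b e)"
  have inj_b': "inj_on b' (edges G)" using b(2) by (auto simp: inj_on_def b'_def)
  have T: "T \<subseteq> verts G" by (auto simp: T_def)
  interpret c1: contraction G S a b n
    using G S a(2) b(2) an by unfold_locales (auto intro: inj_on_subset)
  interpret c2: contraction G T a b' "Suc n"
    using G T a(2) inj_b' an by unfold_locales (fastforce intro: inj_on_subset)+
  define G1 where "G1 = contract G S a b n"
  define G2 where "G2 = contract G T a b' (Suc n)"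
  have bd: "edge_boundary G T = edge_boundary G S"
    unfolding T_def by (rule edge_boundary_complement[OF G])
  have endsV: "ends G e \<subseteq> verts G" if "e \<in> edges G" for e
    using G that by (auto simp: multigraph_def)
  have inc1: "incident_edges G1 n = b ` edge_boundary G S"
    unfolding G1_def by (rule c1.incident_edges_H)
  have inc2: "incident_edges G2 (Suc n) = b' ` edge_boundary G S"
    unfolding G2_def bd[symmetric] by (rule c2.incident_edges_H)
  have verts1: "verts G1 - {n} = a ` S"
    using S an by (auto simp: G1_def c1.verts_H)
  have verts2: "verts G2 - {Suc n} = a ` T"
    using T an by (fastforce simp: G2_def c2.verts_H)
  have edges1: "edges G1 = b ` {e \<in> edges G. ends G e \<inter> S \<noteq> {}}"
    by (simp add: G1_def c1.edges_H)
  have edges2: "edges G2 - incident_edges G2 (Suc n) = b' ` {e \<in> edges G. ends G e \<inter> S = {}}"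
  proof -
    have "{e \<in> edges G. ends G e \<inter> T \<noteq> {}} - edge_boundary G S =
        {e \<in> edges G. ends G e \<inter> S = {}}"
    proof -
      have "ends G e \<noteq> {}" if "e \<in> edges G" for e
        using multigraph_ends[OF G that] by auto
      then show ?thesis using endsV by (fastforce simp: edge_boundary_def T_def)
    qed
    moreover have "b' ` {e \<in> edges G. ends G e \<inter> T \<noteq> {}} - b' ` edge_boundary G S =
        b' ` ({e \<in> edges G. ends G e \<inter> T \<noteq> {}} - edge_boundary G S)"
      by (rule inj_on_image_set_diff[OF inj_b', symmetric]) (auto simp: edge_boundary_def)
    ultimately show ?thesis
      unfolding inc2 by (simp add: G2_def c2.edges_H)
  qed
  define \<psi> where "\<psi> e = (if ends G e \<inter> S \<noteq> {} then b e else b' e)" for e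
  \<comment> \<open>Adding \<open>m\<close> matches the two copies of each boundary edge.\<close>
  define \<pi> where "\<pi> i = m + i" for i
  have \<pi>: "\<pi> (b e) = b' e" for e by (simp add: \<pi>_def b'_def)
  have bij_\<pi>: "bij_betw \<pi> (incident_edges G1 n) (incident_edges G2 (Suc n))"
    unfolding inc1 inc2 by (auto simp: bij_betw_def inj_on_def \<pi>_def b'_def image_image)
  have iso: "isomorphic G (edge_sum G1 n G2 (Suc n) \<pi>)"
    unfolding isomorphic_def
  proof (intro exI[of _ a] exI[of _ \<psi>] conjI ballI)
    have "verts G = S \<union> T" using S by (auto simp: T_def)
    then show "bij_betw a (verts G) (verts (edge_sum G1 n G2 (Suc n) \<pi>))"
      using a(2) verts1 verts2 by (simp add: bij_betw_def edge_sum_def image_Un)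
  next
    have "inj_on \<psi> (edges G)"
    proof (rule inj_onI)
      fix e e' assume e: "e \<in> edges G" "e' \<in> edges G" "\<psi> e = \<psi> e'"
      then have "b e = b e'"
        using bm[OF e(1)] bm[OF e(2)] by (auto simp: \<psi>_def b'_def split: if_splits)
      then show "e = e'" using b(2) e by (auto dest: inj_onD)
    qed
    moreover have "\<psi> ` edges G = edges (edge_sum G1 n G2 (Suc n) \<pi>)"
      using edges1 edges2 by (auto simp: edge_sum_def \<psi>_def)
    ultimately show "bij_betw \<psi> (edges G) (edges (edge_sum G1 n G2 (Suc n) \<pi>))"
      by (simp add: bij_betw_def)
  next
    fix e assume e: "e \<in> edges G"
    have ends1: "ends G1 (b e) = c1.proj ` ends G e"
      unfolding G1_def by (rule c1.ends_H[OF e])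
    have ends2: "ends G2 (b' e) = c2.proj ` ends G e"
      unfolding G2_def by (rule c2.ends_H[OF e])
    have in_inc1: "b e \<in> incident_edges G1 n \<longleftrightarrow> e \<in> edge_boundary G S"
      unfolding inc1 using inj_on_image_mem_iff[OF b(2) e edge_boundary_subset] .
    have b'_not: "b' e \<notin> edges G1" using edges1 bm by (fastforce simp: b'_def)
    consider "e \<in> edge_boundary G S" | "ends G e \<inter> S \<noteq> {}" "ends G e \<subseteq> S" | "ends G e \<inter> S = {}"
      using e by (auto simp: edge_boundary_def)
    then show "ends (edge_sum G1 n G2 (Suc n) \<pi>) (\<psi> e) = a ` ends G e"
    proof cases
      case 1
      then have meets: "ends G e \<inter> S \<noteq> {}" by (auto simp: edge_boundary_def)
      have "ends (edge_sum G1 n G2 (Suc n) \<pi>) (\<psi> e) =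
          (c1.proj ` ends G e - {n}) \<union> (c2.proj ` ends G e - {Suc n})"
        using meets 1 in_inc1 by (simp add: edge_sum_def \<psi>_def \<pi> ends1 ends2)
      also have "c1.proj ` ends G e - {n} = a ` (ends G e \<inter> S)"
        using endsV[OF e] an by fastforce
      also have "c2.proj ` ends G e - {Suc n} = a ` (ends G e \<inter> T)"
        using endsV[OF e] an by fastforce
      also have "a ` (ends G e \<inter> S) \<union> a ` (ends G e \<inter> T) = a ` ends G e"
        using endsV[OF e] by (auto simp: T_def)
      finally show ?thesis .
    next
      case 2
      then have "e \<notin> edge_boundary G S" "b e \<in> edges G1"
        using e edges1 by (auto simp: edge_boundary_def)
      then show ?thesis
        using 2 in_inc1 by (auto simp: edge_sum_def \<psi>_def ends1)
    next
      case 3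
      then have "ends G e \<subseteq> T" using endsV[OF e] by (auto simp: T_def)
      moreover have "b' e \<notin> incident_edges G1 n"
        using b'_not by (simp add: incident_edges_def)
      ultimately show ?thesis
        using 3 b'_not by (auto simp: edge_sum_def \<psi>_def ends2)
    qed
  qed
  have "is_edge_sum_at k G G1 n G2 (Suc n)"
    unfolding is_edge_sum_at_def
  proof (intro conjI exI[of _ \<pi>])
    have "a ` S \<inter> a ` T = {}"
      using inj_on_image_Int[OF a(2) S T] by (auto simp: T_def)
    then show "verts G1 \<inter> verts G2 = {}"
      using an S T by (fastforce simp: G1_def G2_def c1.verts_H c2.verts_H)
    have "edges G1 \<subseteq> {..<m}" using bm by (auto simp: G1_def c1.edges_H)
    moreover have "edges G2 \<subseteq> {m..}" unfolding G2_def c2.edges_H by (auto simp: b'_def)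
    ultimately show "edges G1 \<inter> edges G2 = {}" by fastforce
    show "n \<in> verts G1" "Suc n \<in> verts G2"
      by (simp_all add: G1_def G2_def c1.verts_H c2.verts_H)
    show "degree G1 n = k" "degree G2 (Suc n) = k"
      using c1.degree_H c2.degree_H by (simp_all add: G1_def G2_def k bd)
  qed (rule bij_\<pi> iso)+
  moreover have "edge_disjoint_paths k G1 n (a x)"
    unfolding G1_def by (rule c1.edge_disjoint_paths_H[OF F x]) (use y in simp_all)
  moreover have "edge_disjoint_paths k G2 (Suc n) (a y)"
    unfolding G2_def
    by (rule c2.edge_disjoint_paths_H[OF F(1) linked_sym[OF F(2)] F(3)])
      (use x y in \<open>simp_all add: T_def\<close>)
  moreover have "a x \<in> verts G1" "a x \<noteq> n" "a y \<in> verts G2" "a y \<noteq> Suc n"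
    unfolding G1_def G2_def c1.verts_H c2.verts_H
    using x y S an[of x] an[of y] by (auto simp: T_def)
  ultimately have "is_grounded_edge_sum k G G1 G2"
    unfolding is_grounded_edge_sum_def by blast
  moreover have "admits_weak_immersion G G1"
    unfolding G1_def using c1.admits_weak_immersion_H[OF F[unfolded k] x y] .
  moreover have "admits_weak_immersion G G2"
    unfolding G2_def
  proof (rule c2.admits_weak_immersion_H)
    show "F j \<subseteq> edges G" "linked G (F j) y x" if "j < card (edge_boundary G T)" for j
      using that F(1) linked_sym[OF F(2)] by (simp_all add: bd k)
    show "F i \<inter> F j = {}"
      if "i < card (edge_boundary G T)" "j < card (edge_boundary G T)" "i \<noteq> j" for i j
      using that F(3) by (simp add: bd k)
    show "y \<in> T" "x \<in> verts G - T" using x y S by (auto simp: T_def)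
  qed
  moreover have "multigraph G1" "multigraph G2"
    "card (verts G1) = Suc (card S)" "card (verts G2) = Suc (card (verts G - S))"
    using c1.multigraph_H c2.multigraph_H c1.card_verts_H c2.card_verts_H
    by (simp_all add: G1_def G2_def T_def)
  ultimately show ?thesis by (intro that)
qed

section \<open>A complete graph around a hub vertex\<close>

text \<open>Each \<open>x \<in> X\<close> receives \<open>t\<close> private walks from the hub \<open>v\<close>, and the edge between the
  branch vertices of indices \<open>i\<close> and \<open>j\<close> is routed through \<open>v\<close> along walk number \<open>j\<close> of the
  former and walk number \<open>i\<close> of the latter. The total demand is \<open>t\<^sup>2\<close>.\<close>

lemma complete_graph_immersion_of_hub:
  assumes G: "multigraph G" and v: "v \<in> verts G" and X: "X \<subseteq> verts G - {v}" "card X = t"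
    and conn: "\<And>S. v \<in> S \<Longrightarrow> S \<subseteq> verts G \<Longrightarrow> \<not> X \<subseteq> S \<Longrightarrow> t\<^sup>2 \<le> card (edge_boundary G S)"
  shows "admits_weak_immersion G (complete_graph t)"
proof -
  have fin: "finite X" using X G finite_subset by (fastforce simp: multigraph_def)
  have demand: "(\<Sum>x \<in> X - S. t) \<le> card (edge_boundary G S)" if S: "v \<in> S" "S \<subseteq> verts G" for S
  proof (cases "X \<subseteq> S")
    case True
    then have "X - S = {}" by blast
    then show ?thesis by (simp only: sum.empty le0)
  next
    case False
    have "card (X - S) \<le> t" using card_mono[OF fin Diff_subset] X(2) by metis
    then have "card (X - S) * t \<le> t\<^sup>2" unfolding power2_eq_square by (rule mult_le_mono1)
    then show ?thesis using conn[OF S False] by simp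
  qed
  obtain F where F: "\<And>x j. x \<in> X \<Longrightarrow> j < t \<Longrightarrow> F x j \<subseteq> edges G"
    "\<And>x j. x \<in> X \<Longrightarrow> j < t \<Longrightarrow> linked G (F x j) v x"
    "\<And>x j x' j'. x \<in> X \<Longrightarrow> j < t \<Longrightarrow> x' \<in> X \<Longrightarrow> j' < t \<Longrightarrow> (x, j) \<noteq> (x', j') \<Longrightarrow>
      F x j \<inter> F x' j' = {}"
  proof (rule menger_demands[where D = "\<lambda>_. t", OF G v X(1)])
    show "(\<Sum>x \<in> X - S. t) \<le> card (edge_boundary G S)" if "v \<in> S" "S \<subseteq> verts G" for S
      using that by (rule demand)
  qed (rule that)
  obtain h where h: "bij_betw h {..<t} X"
    using ex_bij_betw_nat_finite[OF fin] X(2) by (metis atLeast0LessThan)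
  have hX: "h i \<in> X" if "i < t" for i using h that by (auto simp: bij_betw_def)
  define L where "L A = (\<Union>i \<in> A. \<Union>j \<in> A - {i}. F (h i) j)" for A
  show ?thesis
    unfolding admits_weak_immersion_iff_linked[OF G multigraph_complete_graph]
  proof (intro exI[of _ h] exI[of _ L] conjI ballI allI impI)
    show "inj_on h (verts (complete_graph t))" "h ` verts (complete_graph t) \<subseteq> verts G"
      using h X(1) by (auto simp: complete_graph_def bij_betw_def)
  next
    fix A assume "A \<in> edges (complete_graph t)"
    then have A: "A \<subseteq> {..<t}" "card A = 2" by (auto simp: complete_graph_def)
    show "L A \<subseteq> edges G"
      unfolding L_def using F(1)[OF hX] A(1) by blast
    fix i j assume "ends (complete_graph t) A = {i, j}"
    then have ij: "A = {i, j}" by (simp add: complete_graph_def)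
    then have "i \<noteq> j" "i < t" "j < t" using A by auto
    then have "linked G (F (h i) j) v (h i)" "linked G (F (h j) i) v (h j)"
      and "F (h i) j \<subseteq> L A" "F (h j) i \<subseteq> L A"
      using F(2) hX by (auto simp: L_def ij)
    then have "linked G (L A) v (h i)" "linked G (L A) v (h j)"
      by (blast intro: linked_mono)+
    then show "linked G (L A) (h i) (h j)"
      by (rule linked_trans[OF linked_sym])
  next
    fix A B assume "A \<in> edges (complete_graph t)" "B \<in> edges (complete_graph t)" "A \<noteq> B"
    then have A: "A \<subseteq> {..<t}" "card A = 2" and B: "B \<subseteq> {..<t}" "card B = 2" and ne: "A \<noteq> B"
      by (auto simp: complete_graph_def)
    have "F (h i) j \<inter> F (h i') j' = {}"
      if i: "i \<in> A" "j \<in> A - {i}" and i': "i' \<in> B" "j' \<in> B - {i'}" for i j i' j'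
    proof (rule F(3))
      show "h i \<in> X" "j < t" "h i' \<in> X" "j' < t" using i i' A(1) B(1) hX by auto
      have "A = {i, j}" "B = {i', j'}" using i i' A(2) B(2) by (auto simp: card_2_iff)
      moreover have "i < t" "i' < t" using i i' A(1) B(1) by auto
      ultimately show "(h i, j) \<noteq> (h i', j')"
        using ne h by (auto simp: bij_betw_def dest: inj_onD)
    qed
    then show "L A \<inter> L B = {}" unfolding L_def by blast
  qed
qed

section \<open>The decomposition\<close>

lemma edge_boundary_singleton:
  assumes "multigraph G"
  shows "edge_boundary G {v} = incident_edges G v"
proof -
  have "\<not> ends G e \<subseteq> {v}" if "e \<in> edges G" for e
    by (rule multigraph_ends[OF assms that]) auto
  then show ?thesis by (auto simp: edge_boundary_def incident_edges_def)
qed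

text \<open>The boundary of a single vertex consists of all edges at it, since there are no loops.\<close>

lemma card_ge_2_of_small_boundary:
  assumes G: "multigraph G" and S: "S \<subseteq> verts G" "v \<in> S"
    and "card (edge_boundary G S) < degree G v"
  shows "2 \<le> card S"
proof (rule ccontr)
  assume "\<not> ?thesis"
  moreover have "finite S" using G finite_subset[OF S(1)] by (simp add: multigraph_def)
  then have "card S \<noteq> 0" using S(2) by auto
  ultimately have "card S = 1" by linarith
  then have "S = {v}" using S(2) by (auto simp: card_1_singleton_iff)
  then show False using assms(4) edge_boundary_singleton[OF G] by (simp add: degree_def)
qed

theorem theorem4:
  fixes t :: nat and G :: "('v, 'e) mgraph"
  assumes "t \<ge> 1"
    and "multigraph G"
    and "\<not> admits_weak_immersion G (complete_graph t)"
  shows "bounded_degree t (t^2) G \<or>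
    (\<exists>(G1 :: (nat, nat) mgraph) (G2 :: (nat, nat) mgraph) (k :: nat).
       multigraph G1 \<and> multigraph G2 \<and>
       \<not> admits_weak_immersion G1 (complete_graph t) \<and>
       \<not> admits_weak_immersion G2 (complete_graph t) \<and>
       k < t^2 \<and>
       is_grounded_edge_sum k G G1 G2 \<and>
       card (verts G1) < card (verts G) \<and>
       card (verts G2) < card (verts G))"
proof (cases "bounded_degree t (t^2) G")
  case True
  then show ?thesis by (rule disjI1)
next
  case False
  define B where "B = {v \<in> verts G. t^2 \<le> degree G v}"
  have B: "t < card B" using False by (simp add: bounded_degree_def B_def)
  note G = assms(2)
  have finV: "finite (verts G)" using G by (simp add: multigraph_def)
  define separates where
    "separates S x y \<longleftrightarrow> S \<subseteq> verts G \<and> x \<in> S \<and> y \<notin> S" for S x y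
  \<comment> \<open>Otherwise any vertex of \<open>B\<close> is a hub for \<open>t\<close> others.\<close>
  have "\<exists>x \<in> B. \<exists>y \<in> B. \<exists>S. separates S x y \<and> card (edge_boundary G S) < t^2"
  proof (rule ccontr)
    assume none: "\<not> ?thesis"
    obtain v where v: "v \<in> B" using B by fastforce
    have "t \<le> card (B - {v})" using v B by simp
    then obtain X where X: "X \<subseteq> B - {v}" "card X = t" by (meson obtain_subset_with_card_n)
    have "admits_weak_immersion G (complete_graph t)"
    proof (rule complete_graph_immersion_of_hub[OF G _ _ X(2)])
      show "v \<in> verts G" "X \<subseteq> verts G - {v}" using v X(1) by (auto simp: B_def)
      fix S assume S: "v \<in> S" "S \<subseteq> verts G" "\<not> X \<subseteq> S"
      then obtain x where "x \<in> B" "separates S v x" using X(1) by (auto simp: separates_def)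
      then show "t\<^sup>2 \<le> card (edge_boundary G S)" using none v by (meson not_le)
    qed
    then show False using assms(3) by contradiction
  qed
  then obtain x y S0 where xy: "x \<in> B" "y \<in> B"
    and S0: "separates S0 x y" "card (edge_boundary G S0) < t^2" by blast
  define S where "S = arg_min (\<lambda>S. card (edge_boundary G S)) (\<lambda>S. separates S x y)"
  have S: "separates S x y"
    and least: "\<And>S'. separates S' x y \<Longrightarrow> card (edge_boundary G S) \<le> card (edge_boundary G S')"
    unfolding S_def using S0(1) arg_min_natI arg_min_nat_le by metis+
  define k where "k = card (edge_boundary G S)"
  have k: "k < t^2" using least[OF S0(1)] S0(2) by (simp add: k_def)
  have SV: "S \<subseteq> verts G" "x \<in> S" "y \<in> verts G - S"
    using S xy(2) by (auto simp: separates_def B_def)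
  obtain F where F: "\<And>j. j < k \<Longrightarrow> F j \<subseteq> edges G" "\<And>j. j < k \<Longrightarrow> linked G (F j) x y"
    "\<And>i j. i < k \<Longrightarrow> j < k \<Longrightarrow> i \<noteq> j \<Longrightarrow> F i \<inter> F j = {}"
  proof (rule menger_edge_disjoint[OF G])
    show "x \<in> verts G" "y \<in> verts G" "x \<noteq> y" using SV by auto
    show "k \<le> card (edge_boundary G S')" if "x \<in> S'" "y \<notin> S'" "S' \<subseteq> verts G" for S'
      using least that by (simp add: separates_def k_def)
  qed (rule that)
  obtain G1 G2 :: "(nat, nat) mgraph" where G12: "multigraph G1" "multigraph G2"
    "admits_weak_immersion G G1" "admits_weak_immersion G G2" "is_grounded_edge_sum k G G1 G2"
    "card (verts G1) = Suc (card S)" "card (verts G2) = Suc (card (verts G - S))"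
    by (rule grounded_edge_sum_of_boundary[OF G SV k_def F]) (simp_all add: that)
  have "\<not> admits_weak_immersion G1 (complete_graph t)" "\<not> admits_weak_immersion G2 (complete_graph t)"
    using admits_weak_immersion_trans[OF G _ multigraph_complete_graph] G12(1-4) assms(3) by blast+
  moreover have "2 \<le> card S"
    using k xy(1) by (intro card_ge_2_of_small_boundary[OF G SV(1,2)]) (simp add: k_def B_def)
  moreover have "2 \<le> card (verts G - S)"
    using k xy(2) SV(3) edge_boundary_complement[OF G, of S]
    by (intro card_ge_2_of_small_boundary[OF G, of _ y]) (auto simp: k_def B_def)
  moreover have "card S + card (verts G - S) = card (verts G)"
    using SV(1) finV by (simp add: card_Diff_subset card_mono finite_subset)
  ultimately show ?thesis
    using G12 k by (intro disjI2 exI[of _ G1] exI[of _ G2] exI[of _ k] conjI) simp_all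
qed

end
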